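(* The following three-variable generating function holds for the set $\mathcal S_1$ of overpartitions defined in the context: $$\sum_{\lambda\in\mathcal{S}_1}a^{\overline{\#}(\lambda)}z^{\lfloor \#(\lambda)/2\rfloor}q^{|\lambda|}=\sum_{n=0}^{\infty}\frac{(-aq^2;q^2)_{n}\,z^n\,q^{n(n+1)}}{(q;q)_{2n+1}}.$$
   Context: $(a;q)_n:=\prod_{j=0}^{n-1}(1-aq^j)$ for $n\ge 0$ (and similarly for base $q^2$). The identity may be read as an identity of formal power series in $q$ with coefficients in $\mathbb Z[a,z]$. A partition is a finite non-increasing sequence $\lambda=(\lambda_1,\ldots,\lambda_\ell)$ of positive integers (the empty partition is allowed). An overpartition is a partition in which the last appearance of each part size may be overlined. $|\lambda|$ is the sum of the parts, $\#(\lambda)=\ell$ the number of parts, and $\overline{\#}(\lambda)$ the number of overlined parts. $\mathcal S_1$ is the set of overpartitions $\lambda=(\lambda_1,\ldots,\lambda_\ell)$ such that: (1) only even-indexed parts $\lambda_{2i}$ may be overlined; (2) for every $i\ge1$ with $2i\le \ell$, $\lambda_{2i}-\lambda_{2i+1}\ge 1$, and $\lambda_{2i}-\lambda_{2i+1}\ge 2$ if $\lambda_{2i}$ is overlined, where differences refer to numerical sizes and $\lambda_{\ell+1}:=0$. *)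

theory Defs
  imports "HOL-Analysis.Infinite_Sum"
    "HOL-Computational_Algebra.Formal_Power_Series"
    "HOL-Computational_Algebra.Polynomial"
begin

(* A part is a pair (size, overlined?); the first part is the head of the list.
   Only the last appearance of a size may be overlined, so an overlined part is never
   followed by a part of the same size. *)
definition overpartition :: "(nat \<times> bool) list \<Rightarrow> bool" where
  "overpartition l \<longleftrightarrow>
     (\<forall>p \<in> set l. fst p > 0) \<and>
     sorted_wrt (\<ge>) (map fst l) \<and>
     (\<forall>i j. i < j \<and> j < length l \<and> snd (l ! i) \<longrightarrow> fst (l ! j) \<noteq> fst (l ! i))"

definition weight :: "(nat \<times> bool) list \<Rightarrow> nat" where
  "weight l = sum_list (map fst l)"

definition num_parts :: "(nat \<times> bool) list \<Rightarrow> nat" where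
  "num_parts l = length l"

definition num_overlined :: "(nat \<times> bool) list \<Rightarrow> nat" where
  "num_overlined l = length (filter snd l)"

(* Indices i \<ge> 1 are 1-based, with size 0 beyond the last part. *)
definition part_size :: "(nat \<times> bool) list \<Rightarrow> nat \<Rightarrow> nat" where
  "part_size l i = (if i \<le> length l then fst (l ! (i - 1)) else 0)"

definition part_overlined :: "(nat \<times> bool) list \<Rightarrow> nat \<Rightarrow> bool" where
  "part_overlined l i \<longleftrightarrow> i \<le> length l \<and> snd (l ! (i - 1))"

definition S1 :: "(nat \<times> bool) list set" where
  "S1 = {l. overpartition l \<and>
     (\<forall>i \<ge> 1. part_overlined l i \<longrightarrow> even i) \<and>
     (\<forall>i \<ge> 1. 2 * i \<le> num_parts l \<longrightarrow>
        int (part_size l (2 * i)) - int (part_size l (2 * i + 1)) \<ge> 1 \<and>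
        (part_overlined l (2 * i) \<longrightarrow>
           int (part_size l (2 * i)) - int (part_size l (2 * i + 1)) \<ge> 2))}"

definition qpoch :: "'a::comm_ring_1 \<Rightarrow> 'a \<Rightarrow> nat \<Rightarrow> 'a" where
  "qpoch x b n = (\<Prod>j<n. 1 - x * b ^ j)"

(* The ring of formal power series in q over Z[a,z]. Here Z[a,z] is int poly poly, i.e. Z[a][z].
   Infinite sums are taken in the library topology of fps (the q-adic one). *)
type_synonym series = "int poly poly fps"

definition var_a :: series where
  "var_a = fps_const [:[:0, 1:]:]"

definition var_z :: series where
  "var_z = fps_const [:0, 1:]"

definition var_q :: series where
  "var_q = fps_X"

(* The library's division of fps needs coefficients with an inverse operation, which Z[a,z] lacks.
   For g with constant coefficient 1, fps_right_inverse g 1 is the unique inverse of g. *)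
definition fps_quot :: "series \<Rightarrow> series \<Rightarrow> series" where
  "fps_quot f g = f * fps_right_inverse g 1"

end

(* Fix n and pad the overpartitions with 2n or 2n+1 parts by a possible final zero to length 2n+1.
   The padded list is determined by its consecutive differences and the overlinings. The i-th
   difference contributes i times its value to the weight; it is arbitrary for odd i, giving
   1/(1 - q^i), and for even i it is at least 1, or at least 2 if overlined, giving
   z q^i (1 + a q^i)/(1 - q^i). The product of these factors is the n-th summand on the right. *)
theory Submission
  imports Defs "HOL-Analysis.Elementary_Metric_Spaces"
begin

unbundle fps_syntax

section \<open>The q-adic topology and infinite sums of power series\<close>

instance fps :: (ab_group_add) topological_comm_monoid_add
proof
  fix a b :: "'a fps"
  show "((\<lambda>x. fst x + snd x) \<longlongrightarrow> a + b) (nhds a \<times>\<^sub>F nhds b)"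
  proof (rule tendsto_fpsI)
    fix n
    have "\<forall>\<^sub>F x in nhds a. x $ n = a $ n" "\<forall>\<^sub>F x in nhds b. x $ n = b $ n"
      using filterlim_ident[of "nhds a"] filterlim_ident[of "nhds b"]
      by (auto simp: tendsto_fps_iff)
    hence "\<forall>\<^sub>F x in nhds a \<times>\<^sub>F nhds b. fst x $ n = a $ n \<and> snd x $ n = b $ n"
      by (rule eventually_prodI)
    thus "\<forall>\<^sub>F x in nhds a \<times>\<^sub>F nhds b. (fst x + snd x) $ n = (a + b) $ n"
      by eventually_elim simp
  qed
qed

text \<open>Coefficient n of a product involves only coefficients 0 to n of the factors, and these
  finitely many coefficients are all locally constant. Continuity of addition and multiplication is
  what the later uses of \<open>has_sum_SigmaI\<close> and \<open>has_sum_cmult_right\<close> rest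
  on.\<close>

instance fps :: (ring_1) topological_semigroup_mult
proof
  fix a b :: "'a fps"
  have ev: "\<forall>\<^sub>F x in nhds c. \<forall>i\<in>{..n}. x $ i = c $ i" for c :: "'a fps" and n
    using filterlim_ident[of "nhds c"]
    by (subst eventually_ball_finite_distrib) (auto simp: tendsto_fps_iff)
  show "((\<lambda>x. fst x * snd x) \<longlongrightarrow> a * b) (nhds a \<times>\<^sub>F nhds b)"
  proof (rule tendsto_fpsI)
    fix n
    have "\<forall>\<^sub>F x in nhds a \<times>\<^sub>F nhds b.
        (\<forall>i\<in>{..n}. fst x $ i = a $ i) \<and> (\<forall>i\<in>{..n}. snd x $ i = b $ i)"
      using ev ev by (rule eventually_prodI)
    thus "\<forall>\<^sub>F x in nhds a \<times>\<^sub>F nhds b. (fst x * snd x) $ n = (a * b) $ n"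
      by eventually_elim (auto simp: fps_mult_nth intro!: sum.cong)
  qed
qed

lemma summable_on_fpsI:
  fixes F :: "'b \<Rightarrow> 'a::ab_group_add fps"
  assumes "\<And>n. finite {x\<in>A. F x $ n \<noteq> 0}"
  shows "F summable_on A"
proof -
  have "(F has_sum Abs_fps (\<lambda>n. \<Sum>x | x \<in> A \<and> F x $ n \<noteq> 0. F x $ n)) A"
    using assms by (rule has_sum_fpsI) simp
  thus ?thesis
    by (rule has_sum_imp_summable)
qed

text \<open>Summing over \<open>B\<close> first gives \<open>F x * T\<close>, then summing over
  \<open>A\<close> gives \<open>S * T\<close>; summability of the double family turns this iterated
  sum into the sum over the product.\<close>

lemma has_sum_fps_mult:
  fixes F :: "'b \<Rightarrow> 'a::comm_ring_1 fps" and G :: "'c \<Rightarrow> 'a fps"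
  assumes F: "(F has_sum S) A" and G: "(G has_sum T) B"
  shows "((\<lambda>(x, y). F x * G y) has_sum S * T) (A \<times> B)"
proof (rule has_sum_SigmaI)
  show "((\<lambda>y. case (x, y) of (x, y) \<Rightarrow> F x * G y) has_sum F x * T) B" for x
    using has_sum_cmult_right[OF G] by simp
  show "((\<lambda>x. F x * T) has_sum S * T) A"
    using F by (rule has_sum_cmult_left)
  show "(\<lambda>(x, y). F x * G y) summable_on A \<times> B"
  proof (rule summable_on_fpsI)
    fix n
    \<comment> \<open>By convolution, a nonzero coefficient n of \<open>F x * G y\<close> forces
      nonzero coefficients i of \<open>F x\<close> and n - i of \<open>G y\<close> for some i \<le>
      n.\<close>
    have "{p \<in> A \<times> B. (case p of (x, y) \<Rightarrow> F x * G y) $ n \<noteq> 0}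
      \<subseteq> (\<Union>i\<le>n. {x\<in>A. F x $ i \<noteq> 0} \<times> {y\<in>B. G y $ (n - i) \<noteq> 0})"
      by (force simp: fps_mult_nth elim!: sum.not_neutral_contains_not_neutral)
    moreover have "finite \<dots>"
      using has_sum_fpsD(1)[OF F] has_sum_fpsD(1)[OF G] by blast
    ultimately show "finite {p \<in> A \<times> B. (case p of (x, y) \<Rightarrow> F x * G y) $ n \<noteq> 0}"
      by (rule finite_subset)
  qed
qed

section \<open>Inverses and geometric series\<close>

lemma fps_right_inverse_unique:
  fixes f g :: "'a::comm_ring_1 fps"
  assumes "f * g = 1" "f $ 0 = 1"
  shows "fps_right_inverse f 1 = g"
proof -
  have "f * fps_right_inverse f 1 = 1"
    using assms(2) by (intro fps_right_inverse) simp
  thus ?thesis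
    using assms(1) by (metis mult.assoc mult.commute mult.right_neutral)
qed

lemma fps_right_inverse_mult:
  fixes f g :: "'a::comm_ring_1 fps"
  assumes "f $ 0 = 1" "g $ 0 = 1"
  shows "fps_right_inverse (f * g) 1 = fps_right_inverse f 1 * fps_right_inverse g 1"
proof (rule fps_right_inverse_unique)
  have "f * fps_right_inverse f 1 = 1" "g * fps_right_inverse g 1 = 1"
    using assms by (auto intro!: fps_right_inverse)
  thus "f * g * (fps_right_inverse f 1 * fps_right_inverse g 1) = 1"
    by (metis mult.assoc mult.left_commute mult.right_neutral)
qed (use assms in simp)

text \<open>Since k > 0, only finitely many powers contribute to a given coefficient, so some sum S
  exists. Splitting off e = 0 gives \<open>S = 1 + fps_X ^ k * S\<close>, which identifies S as the
  inverse.\<close>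

lemma has_sum_fps_geometric:
  fixes k :: nat
  assumes "k > 0"
  shows "((\<lambda>e. fps_X ^ (k * e) :: 'a::comm_ring_1 fps)
            has_sum fps_right_inverse (1 - fps_X ^ k) 1) UNIV"
proof -
  let ?f = "\<lambda>e. fps_X ^ (k * e) :: 'a fps"
  have "finite {e. ?f e $ n \<noteq> 0}" for n
    by (rule finite_subset[of _ "{..n}"]) (use assms in auto)
  hence "?f summable_on UNIV"
    by (intro summable_on_fpsI) simp
  then obtain S where S: "(?f has_sum S) UNIV"
    by (auto simp: summable_on_def)
  have "((\<lambda>e. fps_X ^ k * ?f e) has_sum fps_X ^ k * S) UNIV"
    using S by (rule has_sum_cmult_right)
  hence "((\<lambda>e. ?f (Suc e)) has_sum fps_X ^ k * S) UNIV"
    by (simp add: power_add)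
  hence "(?f has_sum fps_X ^ k * S) (range Suc)"
    by (subst has_sum_reindex) (auto simp: o_def)
  from has_sum_insert[OF _ this, of 0] have "(?f has_sum 1 + fps_X ^ k * S) UNIV"
    by (simp add: UNIV_nat_eq[symmetric])
  with S have "S = 1 + fps_X ^ k * S"
    by (rule has_sum_unique)
  hence "(1 - fps_X ^ k) * S = 1"
    by (simp add: algebra_simps)
  hence "fps_right_inverse (1 - fps_X ^ k) 1 = S"
    using assms by (intro fps_right_inverse_unique) auto
  with S show ?thesis
    by simp
qed

section \<open>Padded lists and their recursive structure\<close>

definition pad :: "(nat \<times> bool) list \<Rightarrow> (nat \<times> bool) list" where
  "pad l = (if even (length l) then l @ [(0, False)] else l)"

text \<open>Positions count from 0, so the parts with even index, which alone may be overlined, sit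
  at the odd positions 2i + 1. The strict gaps leave the last entry as the only one that can be
  0.\<close>

definition padded :: "nat \<Rightarrow> (nat \<times> bool) list set" where
  "padded n = {l. length l = 2 * n + 1 \<and> \<not> snd (l ! (2 * n)) \<and>
     (\<forall>i<n. \<not> snd (l ! (2 * i)) \<and> fst (l ! (2 * i + 1)) \<le> fst (l ! (2 * i)) \<and>
        fst (l ! (2 * i + 2)) + 1 + of_bool (snd (l ! (2 * i + 1))) \<le> fst (l ! (2 * i + 1)))}"

text \<open>Lengthens a padded list by two parts: \<open>m\<close> is the new last part, and the part before it
  exceeds it by its minimal gap plus the slack \<open>e\<close>. Shifting the old parts by that part \<open>t\<close>
  preserves their differences and makes the new gap before \<open>t\<close> the old last part.\<close>
definition extend :: "(nat \<times> bool) list \<times> (bool \<times> nat) \<times> nat \<Rightarrow> (nat \<times> bool) list" where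
  "extend = (\<lambda>(l, (b, e), m). let t = m + 1 + of_bool b + e in
     map (\<lambda>(s, c). (s + t, c)) l @ [(t, b), (m, False)])"

text \<open>Inverse of \<open>extend\<close> on \<open>padded (Suc n)\<close>. The subtractions are
  truncated, but there t is at most every earlier size and at least its own minimal value, so
  nothing is lost.\<close>

definition retract :: "(nat \<times> bool) list \<Rightarrow> (nat \<times> bool) list \<times> (bool \<times> nat) \<times> nat" where
  "retract l = (let k = length l - 2; t = fst (l ! k); b = snd (l ! k); m = fst (l ! (k + 1)) in
     (map (\<lambda>(s, c). (s - t, c)) (take k l), (b, t - (m + 1 + of_bool b)), m))"

text \<open>A single step is the weak inequality at even positions and the gap condition at odd
  ones.\<close>

lemma padded_antimono:
  assumes "l \<in> padded n" "i \<le> j" "j \<le> 2 * n"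
  shows "fst (l ! j) \<le> fst (l ! i)"
  using assms(2,3)
proof (induction j rule: dec_induct)
  case (step j)
  have "fst (l ! Suc j) \<le> fst (l ! j)"
  proof (cases "even j")
    case True
    then obtain i where "j = 2 * i" by blast
    thus ?thesis using assms(1) step.prems by (auto simp: padded_def)
  next
    case False
    then obtain i where "j = 2 * i + 1" by (elim oddE)
    moreover from this have "i < n" using step.prems by auto
    ultimately show ?thesis using assms(1) by (fastforce simp: padded_def)
  qed
  with step show ?case by simp
qed simp

lemma extend_in_padded:
  assumes "l \<in> padded n"
  shows "extend (l, (b, e), m) \<in> padded (Suc n)"
  using assms by (auto simp: padded_def extend_def Let_def nth_append less_Suc_eq case_prod_unfold)

lemma retract_extend: "retract (extend x) = x"
  by (auto simp: extend_def retract_def Let_def nth_append case_prod_unfold comp_def)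

lemma extend_retract:
  assumes l: "l \<in> padded (Suc n)"
  shows "extend (retract l) = l"
proof -
  have len: "length l = 2 * n + 3"
    using l by (simp add: padded_def)
  have eq: "l = take (2 * n + 1) l @ [l ! (2 * n + 1), l ! (2 * n + 2)]"
  proof (rule nth_equalityI)
    fix i assume "i < length l"
    then consider "i < 2 * n + 1" | "i = 2 * n + 1" | "i = 2 * n + 2"
      unfolding len by linarith
    thus "l ! i = (take (2 * n + 1) l @ [l ! (2 * n + 1), l ! (2 * n + 2)]) ! i"
      by cases (auto simp: len nth_append)
  qed (simp add: len)
  let ?t = "fst (l ! (2 * n + 1))" and ?b = "snd (l ! (2 * n + 1))" and ?m = "fst (l ! (2 * n + 2))"
  \<comment> \<open>Makes subtracting and re-adding \<open>?t\<close> the identity on the old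
    parts.\<close>
  have le: "?t \<le> fst p" if "p \<in> set (take (2 * n + 1) l)" for p
    using that padded_antimono[OF l, of _ "2 * n + 1"] by (auto simp: in_set_conv_nth len)
  have 1: "?m + 1 + of_bool ?b \<le> ?t" "\<not> snd (l ! (2 * n + 2))"
    using l by (auto simp: padded_def)
  have 2: "?m + 1 + of_bool ?b + (?t - (?m + 1 + of_bool ?b)) = ?t"
    using 1 by simp
  have "map (\<lambda>(s, c). (s + ?t, c)) (map (\<lambda>(s, c). (s - ?t, c)) (take (2 * n + 1) l))
      = take (2 * n + 1) l"
    unfolding map_map by (rule map_idI) (use le in force)
  hence "extend (retract l) = take (2 * n + 1) l @ [(?t, ?b), (?m, False)]"
    unfolding extend_def retract_def Let_def prod.case using 2 by (simp add: len)
  thus ?thesis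
    using eq 1 by (metis prod.collapse)
qed

lemma retract_in_padded:
  assumes l: "l \<in> padded (Suc n)"
  shows "fst (retract l) \<in> padded n"
proof -
  have len: "length l = 2 * n + 3"
    using l by (simp add: padded_def)
  have ge: "fst (l ! (2 * n + 1)) \<le> fst (l ! i)" if "i \<le> 2 * n + 1" for i
    using that padded_antimono[OF l, of i "2 * n + 1"] by simp
  have nth: "fst (retract l) ! i = (fst (l ! i) - fst (l ! (2 * n + 1)), snd (l ! i))"
    if "i < 2 * n + 1" for i
    using that by (simp add: retract_def Let_def len case_prod_unfold)
  have l': "\<not> snd (l ! (2 * i))" "fst (l ! (2 * i + 1)) \<le> fst (l ! (2 * i))"
    "fst (l ! (2 * i + 2)) + 1 + of_bool (snd (l ! (2 * i + 1))) \<le> fst (l ! (2 * i + 1))"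
    if "i \<le> n" for i
    using l that unfolding padded_def by (auto simp del: add_2_eq_Suc')
  show ?thesis
    unfolding padded_def mem_Collect_eq
  proof (intro conjI allI impI)
    show "length (fst (retract l)) = 2 * n + 1"
      by (simp add: retract_def Let_def len)
    show "\<not> snd (fst (retract l) ! (2 * n))"
      using l'(1)[of n] by (simp add: nth)
    fix i assume i: "i < n"
    show "\<not> snd (fst (retract l) ! (2 * i))"
      using l'(1)[of i] i by (simp add: nth)
    show "fst (fst (retract l) ! (2 * i + 1)) \<le> fst (fst (retract l) ! (2 * i))"
      using l'(2)[of i] i by (simp add: nth)
    \<comment> \<open>Monotonicity of truncated subtraction settles the weak inequality. Preserving
      a gap also requires the lower entry to be at least the subtracted part, which is
      \<open>ge\<close> at position 2i + 2.\<close>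
    show "fst (fst (retract l) ! (2 * i + 2)) + 1 + of_bool (snd (fst (retract l) ! (2 * i + 1)))
        \<le> fst (fst (retract l) ! (2 * i + 1))"
      using l'(3)[of i] i ge[of "2 * i + 2"] by (simp add: nth)
  qed
qed

lemma bij_betw_extend: "bij_betw extend (padded n \<times> (UNIV \<times> UNIV) \<times> UNIV) (padded (Suc n))"
proof (rule bij_betw_byWitness[where f' = retract])
  show "\<forall>x\<in>padded n \<times> (UNIV \<times> UNIV) \<times> UNIV. retract (extend x) = x"
    by (simp add: retract_extend)
  show "\<forall>l\<in>padded (Suc n). extend (retract l) = l"
    by (simp add: extend_retract)
  show "extend ` (padded n \<times> (UNIV \<times> UNIV) \<times> UNIV) \<subseteq> padded (Suc n)"
    by (auto simp: extend_in_padded)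
  show "retract ` padded (Suc n) \<subseteq> padded n \<times> (UNIV \<times> UNIV) \<times> UNIV"
    by (intro image_subsetI) (simp add: mem_Times_iff retract_in_padded)
qed

section \<open>Translating \<open>S1\<close> into padded lists\<close>

lemma length_pad: "length (pad l) = 2 * (length l div 2) + 1"
  by (auto simp: pad_def elim!: oddE)

text \<open>The appended unmarked zero agrees with the values that \<open>part_size\<close> and
  \<open>part_overlined\<close> take just beyond the last part; \<open>Suc\<close> passes from
  positions to 1-based indices.\<close>

lemma nth_pad:
  assumes "i \<le> 2 * (length l div 2)"
  shows "fst (pad l ! i) = part_size l (Suc i)" "snd (pad l ! i) \<longleftrightarrow> part_overlined l (Suc i)"
  using assms by (auto simp: pad_def part_size_def part_overlined_def nth_append elim!: oddE)

text \<open>Positivity is a separate condition because a list of odd length is left unchanged by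
  \<open>pad\<close>, and \<open>padded\<close> would allow its last entry to be 0.\<close>

lemma S1_iff_padded:
  "l \<in> S1 \<longleftrightarrow> (\<forall>p\<in>set l. fst p > 0) \<and> pad l \<in> padded (length l div 2)"
proof
  define n where "n = length l div 2"
  have len: "length l = 2 * n \<or> length l = 2 * n + 1"
    unfolding n_def by presburger
  note nth = nth_pad[of _ l, folded n_def]
  {
    assume l: "l \<in> S1"
    have odd: "\<not> part_overlined l (Suc (2 * i))" for i
      using l unfolding S1_def by fastforce
    have desc: "fst (l ! Suc i) \<le> fst (l ! i)" if "Suc i < length l" for i
      using l that by (auto simp: S1_def overpartition_def sorted_wrt_iff_nth_less)
    have gap: "part_size l (Suc (Suc (Suc (2 * i)))) + 1
          + of_bool (part_overlined l (Suc (Suc (2 * i))))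
        \<le> part_size l (Suc (Suc (2 * i)))" if "i < n" for i
    proof -
      have "1 \<le> Suc i" "2 * Suc i \<le> num_parts l"
        using that len by (auto simp: num_parts_def)
      hence "int (part_size l (2 * Suc i)) - int (part_size l (2 * Suc i + 1)) \<ge> 1 \<and>
        (part_overlined l (2 * Suc i) \<longrightarrow>
           int (part_size l (2 * Suc i)) - int (part_size l (2 * Suc i + 1)) \<ge> 2)"
        using l unfolding S1_def by blast
      thus ?thesis
        by auto
    qed
    have "pad l \<in> padded n"
      unfolding padded_def mem_Collect_eq
    proof (intro conjI allI impI)
      show "length (pad l) = 2 * n + 1"
        by (simp add: length_pad n_def)
      show "\<not> snd (pad l ! (2 * n))"
        using odd by (simp add: nth)
      fix i assume i: "i < n"
      show "\<not> snd (pad l ! (2 * i))"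
        using i odd by (simp add: nth)
      show "fst (pad l ! (2 * i + 1)) \<le> fst (pad l ! (2 * i))"
        using i len desc[of "2 * i"] by (auto simp: nth part_size_def)
      show "fst (pad l ! (2 * i + 2)) + 1 + of_bool (snd (pad l ! (2 * i + 1)))
          \<le> fst (pad l ! (2 * i + 1))"
        using i gap[of i] by (simp add: nth)
    qed
    moreover have "\<forall>p\<in>set l. fst p > 0"
      using l by (simp add: S1_def overpartition_def)
    ultimately show "(\<forall>p\<in>set l. fst p > 0) \<and> pad l \<in> padded (length l div 2)"
      by (simp add: n_def)
  }
  {
    assume "(\<forall>p\<in>set l. fst p > 0) \<and> pad l \<in> padded (length l div 2)"
    hence pos: "\<forall>p\<in>set l. fst p > 0" and p: "pad l \<in> padded n"
      by (auto simp: n_def)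
    have anti: "fst (l ! j) \<le> fst (l ! i)" if "i \<le> j" "j < length l" for i j
      using padded_antimono[OF p, of i j] that len by (auto simp: nth part_size_def)
    have odd: "\<not> part_overlined l (Suc (2 * i))" for i
    proof (cases "i \<le> n")
      case True
      hence "\<not> snd (pad l ! (2 * i))"
        using p by (cases "i = n") (auto simp: padded_def)
      thus ?thesis using True by (simp add: nth)
    next
      case False
      thus ?thesis using len by (auto simp: part_overlined_def)
    qed
    have gap: "part_size l (Suc (Suc (Suc (2 * i)))) + 1
          + of_bool (part_overlined l (Suc (Suc (2 * i))))
        \<le> part_size l (Suc (Suc (2 * i)))" if "i < n" for i
    proof -
      have "fst (pad l ! (2 * i + 2)) + 1 + of_bool (snd (pad l ! (2 * i + 1)))
          \<le> fst (pad l ! (2 * i + 1))"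
        using p that unfolding padded_def by blast
      thus ?thesis using that by (simp add: nth)
    qed
    \<comment> \<open>An overlined part has even 1-based index, so a strict drop follows it; hence
      it is automatically the last of its size.\<close>
    have "fst (l ! j) \<noteq> fst (l ! i)" if "i < j" "j < length l" "snd (l ! i)" for i j
    proof -
      have "part_overlined l (Suc i)"
        using that by (simp add: part_overlined_def)
      with odd have "odd i"
        by blast
      then obtain k where k: "i = Suc (2 * k)"
        by (metis oddE Suc_eq_plus1)
      hence "fst (l ! Suc i) < fst (l ! i)"
        using gap[of k] that len by (auto simp: part_size_def)
      moreover have "fst (l ! j) \<le> fst (l ! Suc i)"
        using that by (intro anti) auto
      ultimately show ?thesis
        by simp
    qed
    hence op: "overpartition l"
      unfolding overpartition_def using pos anti by (auto simp: sorted_wrt_iff_nth_less)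
    \<comment> \<open>An odd index i is 1 + 2 * ((i - 1) div 2), which \<open>odd\<close>
      excludes.\<close>
    have ev: "even i" if "part_overlined l i" "i \<ge> 1" for i
      using that odd[of "(i - 1) div 2"] by (cases "even i") (auto elim!: oddE)
    have "int (part_size l (2 * i)) - int (part_size l (2 * i + 1)) \<ge> 1 \<and>
        (part_overlined l (2 * i) \<longrightarrow>
           int (part_size l (2 * i)) - int (part_size l (2 * i + 1)) \<ge> 2)"
      if i: "i \<ge> 1" "2 * i \<le> num_parts l" for i
    proof -
      obtain k where k: "i = Suc k"
        using i by (cases i) auto
      moreover have "k < n"
        using i k len by (auto simp: num_parts_def)
      ultimately show ?thesis
        using gap[of k] by auto
    qed
    thus "l \<in> S1"
      using op ev by (simp add: S1_def)
  }
qed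

text \<open>Deleting zeros undoes padding, since in a padded list only the last entry can be
  0.\<close>

lemma bij_betw_pad: "bij_betw pad {l \<in> S1. num_parts l div 2 = n} (padded n)"
proof (rule bij_betw_byWitness[where f' = "filter (\<lambda>p. fst p > 0)"])
  show "\<forall>l\<in>{l \<in> S1. num_parts l div 2 = n}. filter (\<lambda>p. fst p > 0) (pad l) = l"
    by (auto simp: S1_iff_padded pad_def)
  show "pad ` {l \<in> S1. num_parts l div 2 = n} \<subseteq> padded n"
    by (auto simp: S1_iff_padded num_parts_def)
  have *: "pad (filter (\<lambda>p. fst p > 0) l) = l \<and>
      length (filter (\<lambda>p. fst p > 0) l) div 2 = n" if l: "l \<in> padded n" for l
  proof -
    have len: "length l = 2 * n + 1" and last: "\<not> snd (l ! (2 * n))"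
      using l by (auto simp: padded_def)
    have eq: "l = take (2 * n) l @ [(fst (l ! (2 * n)), False)]"
      using last by (intro nth_equalityI) (auto simp: len nth_append less_Suc_eq prod_eq_iff)
    have "fst p > 0" if "p \<in> set (take (2 * n) l)" for p
    proof -
      from that obtain i where i: "i < 2 * n" "p = l ! i"
        by (auto simp: in_set_conv_nth len)
      \<comment> \<open>This is position 2n - 1, written in the form 2i + 1 of the gap condition. It
        lies strictly above the last entry, hence is positive, and bounds all earlier entries from
        below.\<close>
      hence "fst (l ! (2 * (n - 1) + 1)) \<le> fst p"
        using padded_antimono[OF l, of i "2 * (n - 1) + 1"] by auto
      moreover have "n - 1 < n"
        using i by simp
      hence "fst (l ! (2 * (n - 1) + 2)) + 1 + of_bool (snd (l ! (2 * (n - 1) + 1)))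
          \<le> fst (l ! (2 * (n - 1) + 1))"
        using l unfolding padded_def by blast
      ultimately show ?thesis
        by simp
    qed
    hence f: "filter (\<lambda>p. fst p > 0) (take (2 * n) l) = take (2 * n) l"
      by (auto intro: filter_True)
    have "filter (\<lambda>p. fst p > 0) l
        = take (2 * n) l @ (if fst (l ! (2 * n)) > 0 then [(fst (l ! (2 * n)), False)] else [])"
      by (subst eq, subst filter_append, subst f) simp
    thus ?thesis
      using eq by (auto simp: pad_def len)
  qed
  thus "\<forall>l\<in>padded n. pad (filter (\<lambda>p. fst p > 0) l) = l"
    by blast
  show "filter (\<lambda>p. fst p > 0) ` padded n \<subseteq> {l \<in> S1. num_parts l div 2 = n}"
    using * by (auto simp: S1_iff_padded num_parts_def)
qed

text \<open>Since parts are positive, the weight bounds both the sizes and the number of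
  parts.\<close>

lemma finite_S1_weight_le: "finite {l \<in> S1. weight l \<le> n}"
proof (rule finite_subset)
  show "{l \<in> S1. weight l \<le> n} \<subseteq> {l. set l \<subseteq> {..n} \<times> UNIV \<and> length l \<le> n}"
  proof
    fix l assume "l \<in> {l \<in> S1. weight l \<le> n}"
    hence l: "l \<in> S1" "weight l \<le> n"
      by auto
    have "fst p \<le> n" if "p \<in> set l" for p
      using that l(2) member_le_sum_list[of "fst p" "map fst l"] by (auto simp: weight_def)
    moreover have "length l \<le> weight l" if "\<forall>p\<in>set l. fst p > 0"
      using that by (induction l) (auto simp: weight_def)
    ultimately show "l \<in> {l. set l \<subseteq> {..n} \<times> UNIV \<and> length l \<le> n}"
      using l by (fastforce simp: S1_iff_padded)
  qed
  show "finite {l :: (nat \<times> bool) list. set l \<subseteq> {..n} \<times> UNIV \<and> length l \<le> n}"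
    by (rule finite_lists_length_le) auto
qed

section \<open>Recursions for the terms of both sides\<close>

definition overpartition_term :: "(nat \<times> bool) list \<Rightarrow> series" where
  "overpartition_term l = var_a ^ num_overlined l * var_z ^ (num_parts l div 2) * var_q ^ weight l"

definition rhs_term :: "nat \<Rightarrow> series" where
  "rhs_term n = fps_quot
      (qpoch (- var_a * var_q ^ 2) (var_q ^ 2) n * var_z ^ n * var_q ^ (n * (n + 1)))
      (qpoch var_q var_q (2 * n + 1))"

text \<open>The added zero has no weight and no mark, and it is added only to an even length, so
  half the length, rounded down, is unchanged.\<close>

lemma overpartition_term_pad: "overpartition_term (pad l) = overpartition_term l"
  by (simp add: overpartition_term_def pad_def num_overlined_def num_parts_def weight_def)

text \<open>The new part t is counted 2n + 2 times: once for itself and once in each of the 2n + 1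
  shifted parts. As t = m + 1 + b + e (b read as 0 or 1), this gives e the weight 2n + 2 and, with
  the last part itself, m the weight 2n + 3.\<close>

lemma overpartition_term_extend:
  assumes "l \<in> padded n"
  shows "overpartition_term (extend (l, (b, e), m)) = overpartition_term l *
     ((var_z * var_a ^ of_bool b * var_q ^ (2 * (n + 1) * (1 + of_bool b))
       * var_q ^ (2 * (n + 1) * e)) * var_q ^ ((2 * n + 3) * m))"
proof -
  have len: "length l = 2 * n + 1"
    using assms by (simp add: padded_def)
  have 1: "num_overlined (extend (l, (b, e), m)) = num_overlined l + of_bool b"
    by (auto simp: num_overlined_def extend_def Let_def filter_map comp_def case_prod_unfold)
  have 2: "num_parts (extend (l, (b, e), m)) div 2 = num_parts l div 2 + 1"
    by (simp add: num_parts_def extend_def Let_def)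
  have shift: "weight (map (\<lambda>(s, c). (s + t, c)) l) = weight l + length l * t" for t
    by (induction l) (auto simp: weight_def)
  have 3: "weight (extend (l, (b, e), m)) =
      weight l + (2 * (n + 1) * (1 + of_bool b) + 2 * (n + 1) * e + (2 * n + 3) * m)"
  proof -
    have "weight (extend (l, (b, e), m))
        = weight (map (\<lambda>(s, c). (s + (m + 1 + of_bool b + e), c)) l)
          + (m + 1 + of_bool b + e) + m"
      by (simp add: extend_def Let_def weight_def)
    thus ?thesis
      unfolding shift len by (simp add: algebra_simps)
  qed
  show ?thesis
    unfolding overpartition_term_def 1 2 3 by (simp only: power_add power_one_right mult_ac)
qed

lemma qpoch_var_q_nth_0: "qpoch var_q var_q n $ 0 = 1"
  by (induction n) (auto simp: qpoch_def var_q_def)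

text \<open>The quotient of consecutive summands, arranged as the sums over b, e and m in
  \<open>overpartition_term_extend\<close>. The power of q comes from (n+1)(n+2) = n(n+1) + 2(n+1);
  the denominator gains two factors.\<close>

lemma rhs_term_Suc:
  "rhs_term (Suc n) = rhs_term n *
     ((var_z * var_q ^ (2 * (n + 1)) * (1 + var_a * var_q ^ (2 * (n + 1)))
       * fps_right_inverse (1 - var_q ^ (2 * (n + 1))) 1)
      * fps_right_inverse (1 - var_q ^ (2 * n + 3)) 1)"
proof -
  have "var_q ^ 2 * (var_q ^ 2) ^ n = var_q ^ (2 * (n + 1))"
    by (simp only: power_mult Suc_eq_plus1[symmetric] power_Suc)
  hence num: "qpoch (- var_a * var_q ^ 2) (var_q ^ 2) (Suc n)
      = qpoch (- var_a * var_q ^ 2) (var_q ^ 2) n * (1 + var_a * var_q ^ (2 * (n + 1)))"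
    by (simp add: qpoch_def mult.assoc)
  have "2 * Suc n + 1 = Suc (Suc (2 * n + 1))"
    by simp
  hence den: "qpoch var_q var_q (2 * Suc n + 1)
      = qpoch var_q var_q (2 * n + 1) * (1 - var_q ^ (2 * (n + 1))) * (1 - var_q ^ (2 * n + 3))"
    by (simp only: qpoch_def prod.lessThan_Suc flip: power_Suc) (simp add: numeral_3_eq_3)
  have inv: "fps_right_inverse (qpoch var_q var_q (2 * Suc n + 1)) 1
      = fps_right_inverse (qpoch var_q var_q (2 * n + 1)) 1
        * fps_right_inverse (1 - var_q ^ (2 * (n + 1))) 1
        * fps_right_inverse (1 - var_q ^ (2 * n + 3)) (1 :: int poly poly)"
    unfolding den
    using qpoch_var_q_nth_0[of "2 * n + 1"]
    by (simp add: fps_right_inverse_mult var_q_def)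
  have e: "Suc n * (Suc n + 1) = n * (n + 1) + 2 * (n + 1)"
    by simp
  show ?thesis
    unfolding rhs_term_def fps_quot_def inv num e power_add[of _ "n * (n + 1)"] power_Suc
    by (simp only: mult_ac)
qed

text \<open>Induction on n: along the bijection \<open>extend\<close> the term splits into a
  product, so the sum is the previous one times independent sums over b, e and m.\<close>

lemma has_sum_padded: "(overpartition_term has_sum rhs_term n) (padded n)"
proof (induction n)
  case 0
  \<comment> \<open>The base case is a single unmarked entry of any size; size 0 stands for the
    empty overpartition.\<close>
  have bij: "bij_betw (\<lambda>m. [(m, False)]) UNIV (padded 0)"
    by (rule bij_betwI'[where ?Y = "padded 0"]) (auto simp: padded_def length_Suc_conv)
  have r: "rhs_term 0 = fps_right_inverse (1 - fps_X ^ 1) 1"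
    by (simp add: rhs_term_def fps_quot_def qpoch_def var_q_def)
  have "((\<lambda>m. overpartition_term [(m, False)]) has_sum rhs_term 0) UNIV"
    using has_sum_fps_geometric[of 1, where ?'a = "int poly poly"] unfolding r
    by (simp add: overpartition_term_def num_overlined_def num_parts_def weight_def var_q_def)
  thus ?case
    by (simp add: has_sum_reindex_bij_betw[OF bij])
next
  case (Suc n)
  let ?k = "2 * (n + 1)"
  \<comment> \<open>With k = 2(n+1), the plain part gives z q^k and the overlined one z a
    q^(2k).\<close>
  have fin: "((\<lambda>b. var_z * var_a ^ of_bool b * var_q ^ (k * (1 + of_bool b)))
      has_sum var_z * var_q ^ k * (1 + var_a * var_q ^ k)) (UNIV :: bool set)" for k :: nat
    by (rule has_sum_finiteI) (simp_all add: UNIV_bool power_add mult_2_right algebra_simps)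
  have geom: "((\<lambda>e. var_q ^ (k * e)) has_sum fps_right_inverse (1 - var_q ^ k) 1) UNIV"
    if "k > 0" for k :: nat
    using has_sum_fps_geometric[OF that] by (simp add: var_q_def)
  let ?F = "\<lambda>(b, e). var_z * var_a ^ of_bool b * var_q ^ (?k * (1 + of_bool b)) * var_q ^ (?k * e)"
  have "(?F has_sum var_z * var_q ^ ?k * (1 + var_a * var_q ^ ?k)
      * fps_right_inverse (1 - var_q ^ ?k) 1) (UNIV \<times> UNIV)"
    by (rule has_sum_fps_mult[OF fin geom]) simp
  from has_sum_fps_mult[OF this geom[of "2 * n + 3"]] have
    "((\<lambda>(x, m). ?F x * var_q ^ ((2 * n + 3) * m)) has_sum
        var_z * var_q ^ ?k * (1 + var_a * var_q ^ ?k) * fps_right_inverse (1 - var_q ^ ?k) 1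
        * fps_right_inverse (1 - var_q ^ (2 * n + 3)) 1) ((UNIV \<times> UNIV) \<times> UNIV)"
    by simp
  from has_sum_fps_mult[OF Suc.IH this]
  have "((\<lambda>(l, y). overpartition_term l * (case y of (x, m) \<Rightarrow> ?F x * var_q ^ ((2 * n + 3) * m)))
      has_sum rhs_term (Suc n)) (padded n \<times> (UNIV \<times> UNIV) \<times> UNIV)"
    unfolding rhs_term_Suc .
  also have "?this \<longleftrightarrow> ((\<lambda>x. overpartition_term (extend x)) has_sum rhs_term (Suc n))
      (padded n \<times> (UNIV \<times> UNIV) \<times> UNIV)"
    by (rule has_sum_cong) (auto simp only: overpartition_term_extend prod.case mem_Times_iff fst_conv
        split: prod.splits)
  finally show ?case
    by (simp only: has_sum_reindex_bij_betw[OF bij_betw_extend])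
qed

section \<open>Summation over all of \<open>S1\<close>\<close>

lemma summable_on_S1: "overpartition_term summable_on S1"
proof (rule summable_on_fpsI)
  fix n
  \<comment> \<open>A term of weight above n is divisible by a power of q above n, so its
    coefficient n vanishes.\<close>
  have "{l \<in> S1. overpartition_term l $ n \<noteq> 0} \<subseteq> {l \<in> S1. weight l \<le> n}"
    by (auto simp: overpartition_term_def var_q_def fps_X_power_mult_right_nth
        split: if_splits)
  thus "finite {l \<in> S1. overpartition_term l $ n \<noteq> 0}"
    using finite_S1_weight_le by (rule finite_subset)
qed

text \<open>\<open>S1\<close> is partitioned by half the number of parts, rounded down. The class of
  n sums to \<open>rhs_term n\<close>, and summability over \<open>S1\<close> permits summing class
  by class.\<close>

lemma rhs_term_sums: "rhs_term sums (\<Sum>\<^sub>\<infinity>l\<in>S1. overpartition_term l)"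
proof -
  define B where "B n = {l \<in> S1. num_parts l div 2 = n}" for n
  have "bij_betw snd (Sigma UNIV B) S1"
    by (rule bij_betw_byWitness[where f' = "\<lambda>l. (num_parts l div 2, l)"]) (auto simp: B_def)
  from has_sum_reindex_bij_betw[OF this, of overpartition_term] summable_on_S1
  have "((\<lambda>x. overpartition_term (snd x)) has_sum (\<Sum>\<^sub>\<infinity>l\<in>S1. overpartition_term l)) (Sigma UNIV B)"
    by (simp add: has_sum_infsum)
  moreover have "((\<lambda>l. overpartition_term (snd (n, l))) has_sum rhs_term n) (B n)" for n
    using has_sum_padded[of n] has_sum_reindex_bij_betw[OF bij_betw_pad[of n], of overpartition_term]
    by (simp add: overpartition_term_pad B_def)
  ultimately have "(rhs_term has_sum (\<Sum>\<^sub>\<infinity>l\<in>S1. overpartition_term l)) UNIV"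
    by (rule has_sum_SigmaD)
  thus ?thesis
    by (rule has_sum_imp_sums)
qed

theorem theorem4p4:
  defines "lhs \<equiv> (\<lambda>l. var_a ^ num_overlined l * var_z ^ (num_parts l div 2) * var_q ^ weight l)"
    and "rhs \<equiv> (\<lambda>n. fps_quot
            (qpoch (- var_a * var_q ^ 2) (var_q ^ 2) n * var_z ^ n * var_q ^ (n * (n + 1)))
            (qpoch var_q var_q (2 * n + 1)))"
  shows "lhs summable_on S1 \<and> summable rhs \<and> (\<Sum>\<^sub>\<infinity>l\<in>S1. lhs l) = (\<Sum>n. rhs n)"
proof -
  have "lhs = overpartition_term" "rhs = rhs_term"
    by (auto simp: lhs_def rhs_def overpartition_term_def rhs_term_def fun_eq_iff)
  thus ?thesis
    using summable_on_S1 rhs_term_sums by (simp add: sums_iff)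
qed

end
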